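(* Every operator $H\in\mathcal{S}_Y(c_0)$ is represented by a matrix whose entries are integrals with respect to scalar measures: there exists $f\in C(\mathbb{N}^{*})$ such that for all $i,j\in\mathbb{N}$ $$\langle H(e_i),e_j\rangle=\int_{\mathbb{N}^{*}}f\,dm_{ij},$$ where $m_{ij}:\Omega(\mathbb{N}^{*})\to\mathbb{K}$ is the scalar measure $m_{ij}(C)=\langle m(C)e_i,e_j\rangle$ and the integral is as defined in the context.
   Context: $\mathbb{K}$ is a complete non-archimedean valued field whose residue class field is formally real. $c_0$ is the Banach space of sequences $x=(x_n)_{n\in\mathbb{N}}$ in $\mathbb{K}$ with $x_n\to 0$ ($\mathbb{N}=\{1,2,\dots\}$), with norm $\|x\|_\infty=\sup_n|x_n|$, canonical basis $(e_n)$ and bilinear form $\langle x,y\rangle=\sum_n x_ny_n$; one has $\|x\|_\infty=\sqrt{|\langle x,x\rangle|}$. $Y=\{y^{(i)}\}_{i\in\mathbb{N}}$ is a fixed orthonormal sequence in $c_0$: $\langle y^{(i)},y^{(j)}\rangle=0$ for $i\ne j$ and $\|y^{(i)}\|_\infty=1$. Put $P_i(x)=\frac{\langle x,y^{(i)}\rangle}{\langle y^{(i)},y^{(i)}\rangle}y^{(i)}$. For $\lambda=(\lambda_i)\in c_0$ let $T_\lambda=\sum_{i=1}^\infty\lambda_iP_i$. $\mathcal{S}_Y(c_0)=\{\alpha Id+T_\lambda:\alpha\in\mathbb{K},\lambda\in c_0\}$, where $Id$ is the identity operator, with the operator norm and composition. $\mathbb{N}^{*}=\mathbb{N}\cup\{0\}$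 is the one-point compactification of the discrete space $\mathbb{N}$, with $0$ as the point at infinity; $C(\mathbb{N}^{*})$ is the algebra of continuous functions $\mathbb{N}^{*}\to\mathbb{K}$ with the supremum norm. $\Omega(\mathbb{N}^{*})$ is the Boolean ring of clopen subsets of $\mathbb{N}^{*}$; its elements are exactly the finite subsets of $\mathbb{N}$ and their complements in $\mathbb{N}^{*}$. The finitely additive set function $m:\Omega(\mathbb{N}^{*})\to\mathcal{S}_Y(c_0)$ is given by $m(\varnothing)=0$, $m(\mathbb{N}^{*})=Id$, $m(\{n_1,\dots,n_k\})=\sum_{i=1}^kP_{n_i}$ and $m(\mathbb{N}^{*}\setminus\{n_1,\dots,n_k\})=Id-\sum_{i=1}^kP_{n_i}$ for distinct $n_1,\dots,n_k\in\mathbb{N}$. $\mathcal{D}_{\mathbb{N}^{*}}$ is the set of all $\alpha=\{C_1,\dots,C_n;x_1,\dots,x_n\}$ where $\{C_1,\dots,C_n\}$ is a finite partition of $\mathbb{N}^{*}$ into (nonempty) clopen sets and $x_k\in C_k$; it is directed by $\alpha_1\ge\alpha_2$ iff the partition of $\alpha_1$ refines the partition of $\alpha_2$. For $f\in C(\mathbb{N}^{*})$, $\int_{\mathbb{N}^{*}}f\,dm_{ij}=\lim_{\alpha\in\mathcal{D}_{\mathbb{N}^{*}}}\sum_{k=1}^nf(x_k)\,m_{ij}(C_k)$. *)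

theory Defs
  imports "HOL-Analysis.Analysis" "HOL-Algebra.QuotRing"
begin

section \<open>Non-archimedean valued fields\<close>

text \<open>
  The library reserves its constant \<open>norm\<close> for real normed vector spaces, so
  non-archimedean norms get a constant of their own. The norm axioms
  \<open>\<parallel>x\<parallel> = 0 \<longleftrightarrow> x = 0\<close> and \<open>\<parallel>-x\<parallel> = \<parallel>x\<parallel>\<close> follow from the axioms of a metric.
\<close>

class nonarch_normed_group = ab_group_add + metric_space +
  fixes nnorm :: "'a \<Rightarrow> real"
  assumes dist_nnorm: "dist x y = nnorm (x - y)"
    and nnorm_ultra: "nnorm (x + y) \<le> max (nnorm x) (nnorm y)"

class complete_nonarch_field = field + nonarch_normed_group + complete_space +
  assumes nnorm_mult: "nnorm (x * y) = nnorm x * nnorm y"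

definition valuation_ring :: "'a::complete_nonarch_field ring" where
  "valuation_ring = \<lparr>carrier = {x. nnorm x \<le> 1}, mult = (*), one = 1, zero = 0, add = (+)\<rparr>"

definition residue_field :: "'a::complete_nonarch_field set ring" where
  "residue_field = valuation_ring Quot {x. nnorm x < 1}"

definition formally_real :: "('b, 'c) ring_scheme \<Rightarrow> bool" where
  "formally_real F \<longleftrightarrow>
     (\<forall>(n::nat) a. a \<in> {..<n} \<rightarrow> carrier F \<longrightarrow>
        (\<Oplus>\<^bsub>F\<^esub>i\<in>{..<n}. a i \<otimes>\<^bsub>F\<^esub> a i) = \<zero>\<^bsub>F\<^esub> \<longrightarrow> (\<forall>i<n. a i = \<zero>\<^bsub>F\<^esub>))"

lemma nnorm_eq_dist: "nnorm (x::'a::nonarch_normed_group) = dist x 0"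
  by (simp add: dist_nnorm)

lemma nnorm_nonneg [simp]: "0 \<le> nnorm (x::'a::nonarch_normed_group)"
  by (simp add: nnorm_eq_dist)

lemma nnorm_zero [simp]: "nnorm (0::'a::nonarch_normed_group) = 0"
  by (simp add: nnorm_eq_dist)

lemma nnorm_eq_zero [simp]: "nnorm (x::'a::nonarch_normed_group) = 0 \<longleftrightarrow> x = 0"
  by (simp add: nnorm_eq_dist)

lemma nnorm_minus [simp]: "nnorm (- x) = nnorm (x::'a::nonarch_normed_group)"
  using dist_nnorm[of 0 x] dist_nnorm[of x 0] by (simp add: dist_commute)

lemma nnorm_diff_ultra: "nnorm (x - y) \<le> max (nnorm x) (nnorm (y::'a::nonarch_normed_group))"
  using nnorm_ultra[of x "- y"] by simp

instance nonarch_normed_group \<subseteq> topological_ab_group_add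
proof
  fix a b :: 'a
  show "((\<lambda>x. fst x + snd x) \<longlongrightarrow> a + b) (nhds a \<times>\<^sub>F nhds b)"
  proof (rule tendstoI)
    fix e :: real assume "e > 0"
    have "\<forall>\<^sub>F x in nhds a \<times>\<^sub>F nhds b. dist (fst x) a < e \<and> dist (snd x) b < e"
      using \<open>e > 0\<close> by (intro eventually_conj)
        (auto intro!: tendstoD filterlim_fst filterlim_snd)
    then show "\<forall>\<^sub>F x in nhds a \<times>\<^sub>F nhds b. dist (fst x + snd x) (a + b) < e"
    proof (rule eventually_mono)
      fix x :: "'a \<times> 'a" assume *: "dist (fst x) a < e \<and> dist (snd x) b < e"
      have "dist (fst x + snd x) (a + b) = nnorm ((fst x - a) + (snd x - b))"
        by (simp add: dist_nnorm algebra_simps)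
      also have "\<dots> < e"
        using * nnorm_ultra[of "fst x - a" "snd x - b"]
        by (simp only: dist_nnorm) linarith
      finally show "dist (fst x + snd x) (a + b) < e" .
    qed
  qed
  show "(uminus \<longlongrightarrow> - a) (nhds a)"
  proof (rule tendstoI)
    fix e :: real assume "e > 0"
    have "dist (- x) (- a) = dist x a" for x :: 'a
      using nnorm_minus[of "x - a"] by (simp add: dist_nnorm)
    then show "\<forall>\<^sub>F x in nhds a. dist (- x) (- a) < e"
      using tendstoD[OF filterlim_ident \<open>e > 0\<close>, of a] by simp
  qed
qed

lemma tendsto_nnorm:
  "(f \<longlongrightarrow> (l::'a::nonarch_normed_group)) F \<Longrightarrow> ((\<lambda>x. nnorm (f x)) \<longlongrightarrow> nnorm l) F"
  by (simp add: nnorm_eq_dist tendsto_dist)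

lemma tendsto_zero_nnorm_iff:
  "(f \<longlongrightarrow> (0::'a::nonarch_normed_group)) F \<longleftrightarrow> ((\<lambda>x. nnorm (f x)) \<longlongrightarrow> 0) F"
  by (simp add: nnorm_eq_dist tendsto_dist_iff[of f])

lemma nnorm_sum_le:
  assumes "\<And>i. i \<in> A \<Longrightarrow> nnorm (f i :: 'a::nonarch_normed_group) \<le> B" "0 \<le> B"
  shows "nnorm (sum f A) \<le> B"
  using assms
proof (induction A rule: infinite_finite_induct)
  case (insert x F)
  then have "nnorm (f x) \<le> B" "nnorm (sum f F) \<le> B" by auto
  then have "nnorm (f x + sum f F) \<le> B"
    using nnorm_ultra[of "f x" "sum f F"] by linarith
  with insert.hyps show ?case by simp
qed auto

lemma nonarch_summable:
  fixes f :: "nat \<Rightarrow> 'a::{nonarch_normed_group, complete_space}"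
  assumes "f \<longlonglongrightarrow> 0"
  shows "summable f"
proof -
  have "Cauchy (\<lambda>n. sum f {..<n})"
  proof (rule metric_CauchyI)
    fix e :: real assume e: "e > 0"
    from assms e obtain N where N: "\<And>n. n \<ge> N \<Longrightarrow> nnorm (f n) < e / 2"
      unfolding lim_sequentially nnorm_eq_dist by (meson half_gt_zero)
    have *: "dist (sum f {..<m}) (sum f {..<n}) < e" if "N \<le> m" "m \<le> n" for m n
    proof -
      have "sum f {..<n} - sum f {..<m} = sum f {m..<n}"
        using that by (metis lessThan_atLeast0 sum_diff_nat_ivl zero_le)
      moreover have "nnorm (sum f {m..<n}) \<le> e / 2"
      proof (rule nnorm_sum_le)
        fix i assume "i \<in> {m..<n}"
        then show "nnorm (f i) \<le> e / 2"
          using N[of i] that by simp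
      qed (use e in simp)
      ultimately show ?thesis
        using e dist_nnorm[of "sum f {..<n}" "sum f {..<m}"] by (simp add: dist_commute)
    qed
    show "\<exists>M. \<forall>m\<ge>M. \<forall>n\<ge>M. dist (sum f {..<m}) (sum f {..<n}) < e"
    proof (intro exI allI impI)
      fix m n assume "N \<le> m" "N \<le> n"
      then show "dist (sum f {..<m}) (sum f {..<n}) < e"
        using *[of m n] *[of n m] by (cases "m \<le> n") (auto simp: dist_commute)
    qed
  qed
  then show ?thesis
    by (simp add: summable_iff_convergent Cauchy_convergent_iff)
qed

lemma nnorm_suminf_le:
  fixes f :: "nat \<Rightarrow> 'a::nonarch_normed_group"
  assumes "summable f" "\<And>n. nnorm (f n) \<le> B"
  shows "nnorm (suminf f) \<le> B"
proof -
  have "0 \<le> B" using assms(2)[of 0] nnorm_nonneg[of "f 0"] by linarith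
  have "(\<lambda>n. nnorm (sum f {..<n})) \<longlonglongrightarrow> nnorm (suminf f)"
    using assms(1) by (intro tendsto_nnorm summable_LIMSEQ)
  then show ?thesis
    by (rule Lim_bounded) (use \<open>0 \<le> B\<close> assms(2) in \<open>auto intro: nnorm_sum_le\<close>)
qed

lemma nonarch_suminf_mult:
  fixes f :: "nat \<Rightarrow> 'a::complete_nonarch_field"
  assumes "summable f"
  shows "(\<Sum>n. c * f n) = c * suminf f"
proof -
  have "(\<lambda>n. c * sum f {..<n} - c * suminf f) \<longlonglongrightarrow> 0"
  proof -
    have "(\<lambda>n. dist (sum f {..<n}) (suminf f)) \<longlonglongrightarrow> 0"
      by (rule iffD1[OF tendsto_dist_iff summable_LIMSEQ[OF assms]])
    then have "(\<lambda>n. nnorm c * nnorm (sum f {..<n} - suminf f)) \<longlonglongrightarrow> nnorm c * 0"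
      by (intro tendsto_mult tendsto_const) (simp add: dist_nnorm)
    then show ?thesis
      by (simp add: tendsto_zero_nnorm_iff nnorm_mult right_diff_distrib[symmetric])
  qed
  from tendsto_add[OF this tendsto_const[of "c * suminf f"]]
  have "(\<lambda>n. c * f n) sums (c * suminf f)"
    by (simp add: sums_def sum_distrib_left)
  then show ?thesis by (simp add: sums_iff)
qed


section \<open>The space of null sequences\<close>

text \<open>
  The index set of sequences is the type \<^typ>\<open>nat\<close>: the entry with index \<open>n\<close> is the
  \<open>(n + 1)\<close>-st entry in the numbering of sequences from \<open>1\<close>.
\<close>

typedef (overloaded) 'a c0 = "{x :: nat \<Rightarrow> 'a::complete_nonarch_field. x \<longlonglongrightarrow> 0}"
  morphisms c0_nth Abs_c0
  by (rule exI[of _ "\<lambda>_. 0"]) simp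

setup_lifting type_definition_c0

lemma c0_nth_tendsto: "c0_nth x \<longlonglongrightarrow> 0"
  using c0_nth[of x] by simp

lemma c0_eqI: "(\<And>n. c0_nth x n = c0_nth y n) \<Longrightarrow> x = y"
  by (metis c0_nth_inject ext)

lemma c0_bdd_above: "bdd_above (range (\<lambda>n. nnorm (c0_nth x n)))"
proof -
  have "bounded (range (c0_nth x))"
    by (rule convergent_imp_bounded[OF c0_nth_tendsto])
  then obtain B where "\<And>n. dist 0 (c0_nth x n) \<le> B"
    by (auto simp: bounded_any_center[of _ 0])
  then show ?thesis
    by (intro bdd_aboveI2[of _ _ B]) (simp add: nnorm_eq_dist dist_commute)
qed

instantiation c0 :: (complete_nonarch_field) ab_group_add
begin

lift_definition zero_c0 :: "'a c0" is "\<lambda>_. 0" by simp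
lift_definition plus_c0 :: "'a c0 \<Rightarrow> 'a c0 \<Rightarrow> 'a c0" is "\<lambda>x y n. x n + y n"
  using tendsto_add by fastforce
lift_definition minus_c0 :: "'a c0 \<Rightarrow> 'a c0 \<Rightarrow> 'a c0" is "\<lambda>x y n. x n - y n"
  using tendsto_diff by fastforce
lift_definition uminus_c0 :: "'a c0 \<Rightarrow> 'a c0" is "\<lambda>x n. - x n"
  using tendsto_minus by fastforce

instance
  by standard (transfer, simp add: algebra_simps)+

end

instantiation c0 :: (complete_nonarch_field) nonarch_normed_group
begin

definition nnorm_c0 :: "'a c0 \<Rightarrow> real" where
  "nnorm_c0 x = (SUP n. nnorm (c0_nth x n))"

definition dist_c0 :: "'a c0 \<Rightarrow> 'a c0 \<Rightarrow> real" where
  "dist_c0 x y = nnorm (x - y)"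

definition uniformity_c0 :: "('a c0 \<times> 'a c0) filter" where
  "uniformity_c0 = (INF e\<in>{0<..}. principal {(x, y). dist x y < e})"

definition open_c0 :: "'a c0 set \<Rightarrow> bool" where
  "open_c0 U = (\<forall>x\<in>U. \<forall>\<^sub>F (x', y) in uniformity. x' = x \<longrightarrow> y \<in> U)"

instance
proof
  have le: "nnorm (c0_nth x n) \<le> nnorm x" for x :: "'a c0" and n
    unfolding nnorm_c0_def by (rule cSUP_upper[OF UNIV_I c0_bdd_above])
  have least: "nnorm x \<le> B" if "\<And>n. nnorm (c0_nth x n) \<le> B" for x :: "'a c0" and B
    unfolding nnorm_c0_def using that by (intro cSUP_least) auto
  show ultra: "nnorm (x + y) \<le> max (nnorm x) (nnorm y)" for x y :: "'a c0"
  proof (rule least)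
    fix n
    have "nnorm (c0_nth (x + y) n) \<le> max (nnorm (c0_nth x n)) (nnorm (c0_nth y n))"
      by (simp add: plus_c0.rep_eq nnorm_ultra)
    also have "\<dots> \<le> max (nnorm x) (nnorm y)"
      by (intro max.mono le)
    finally show "nnorm (c0_nth (x + y) n) \<le> max (nnorm x) (nnorm y)" .
  qed
  have nonneg: "0 \<le> nnorm x" for x :: "'a c0"
    using le[of x 0] nnorm_nonneg order_trans by blast
  show "dist x y = 0 \<longleftrightarrow> x = y" for x y :: "'a c0"
  proof
    assume "dist x y = 0"
    then have "nnorm (c0_nth (x - y) n) \<le> 0" for n
      using le[of "x - y" n] by (simp add: dist_c0_def)
    then have "nnorm (c0_nth (x - y) n) = 0" for n
      using nnorm_nonneg order_antisym by blast
    then show "x = y"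
      by (intro c0_eqI) (simp add: minus_c0.rep_eq)
  next
    assume "x = y"
    then show "dist x y = 0"
      by (simp add: dist_c0_def nnorm_c0_def zero_c0.rep_eq)
  qed
  have minus: "nnorm (x - y) = nnorm (y - x)" for x y :: "'a c0"
  proof -
    have "nnorm (c0_nth x n - c0_nth y n) = nnorm (c0_nth y n - c0_nth x n)" for n
      using nnorm_minus[of "c0_nth x n - c0_nth y n"] by simp
    then show ?thesis by (simp add: nnorm_c0_def minus_c0.rep_eq)
  qed
  show "dist x y \<le> dist x z + dist y z" for x y z :: "'a c0"
    using ultra[of "x - z" "z - y"] nonneg[of "x - z"] nonneg[of "z - y"] minus[of y z]
    by (simp add: dist_c0_def)
qed (simp_all add: dist_c0_def uniformity_c0_def open_c0_def)

end

lemma nnorm_c0_nth_le: "nnorm (c0_nth x n) \<le> nnorm x"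
  unfolding nnorm_c0_def by (rule cSUP_upper[OF UNIV_I c0_bdd_above])

lemma nnorm_c0_least: "(\<And>n. nnorm (c0_nth x n) \<le> B) \<Longrightarrow> nnorm x \<le> B"
  unfolding nnorm_c0_def by (intro cSUP_least) auto

lift_definition c0_scale :: "'a::complete_nonarch_field \<Rightarrow> 'a c0 \<Rightarrow> 'a c0"
  is "\<lambda>c x n. c * x n"
proof -
  fix c :: 'a and x :: "nat \<Rightarrow> 'a"
  assume "x \<longlonglongrightarrow> 0"
  then have "(\<lambda>n. nnorm c * nnorm (x n)) \<longlonglongrightarrow> nnorm c * 0"
    by (intro tendsto_mult tendsto_const) (simp add: tendsto_zero_nnorm_iff)
  then show "(\<lambda>n. c * x n) \<longlonglongrightarrow> 0"
    by (simp add: tendsto_zero_nnorm_iff nnorm_mult)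
qed

lift_definition c0_basis :: "nat \<Rightarrow> 'a::complete_nonarch_field c0" is "\<lambda>i n. if n = i then 1 else 0"
proof -
  fix i :: nat
  have "\<forall>\<^sub>F n in sequentially. (if n = i then 1 else 0 :: 'a) = 0"
    by (rule eventually_sequentiallyI[of "Suc i"]) simp
  then show "(\<lambda>n. if n = i then 1 else 0 :: 'a) \<longlonglongrightarrow> 0"
    by (simp add: tendsto_eventually)
qed

definition c0_form :: "'a::complete_nonarch_field c0 \<Rightarrow> 'a c0 \<Rightarrow> 'a" where
  "c0_form x y = (\<Sum>n. c0_nth x n * c0_nth y n)"

definition orthonormal_seq :: "(nat \<Rightarrow> 'a::complete_nonarch_field c0) \<Rightarrow> bool" where
  "orthonormal_seq y \<longleftrightarrow>
     (\<forall>i j. i \<noteq> j \<longrightarrow> c0_form (y i) (y j) = 0) \<and> (\<forall>i. nnorm (y i) = 1)"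

lemma nnorm_c0_scale_le: "nnorm (c0_scale c x) \<le> nnorm c * nnorm x"
  by (rule nnorm_c0_least)
    (simp add: c0_scale.rep_eq nnorm_mult mult_left_mono nnorm_c0_nth_le)

lemma vector_space_c0_scale: "vector_space (c0_scale :: 'a::complete_nonarch_field \<Rightarrow> _)"
  by standard (transfer, simp add: algebra_simps)+

lemma c0_form_summable: "summable (\<lambda>n. c0_nth x n * c0_nth y n)"
proof (rule nonarch_summable)
  have "(\<lambda>n. nnorm (c0_nth x n) * nnorm (c0_nth y n)) \<longlonglongrightarrow> 0 * 0"
    by (intro tendsto_mult) (simp_all add: tendsto_zero_nnorm_iff[symmetric] c0_nth_tendsto)
  then show "(\<lambda>n. c0_nth x n * c0_nth y n) \<longlonglongrightarrow> 0"
    by (simp add: tendsto_zero_nnorm_iff nnorm_mult)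
qed

lemma c0_form_add_left: "c0_form (x + z) y = c0_form x y + c0_form z y"
  unfolding c0_form_def
  by (simp add: plus_c0.rep_eq distrib_right suminf_add[symmetric] c0_form_summable)

lemma c0_form_scale_left: "c0_form (c0_scale c x) y = c * c0_form x y"
  unfolding c0_form_def
  by (simp add: c0_scale.rep_eq mult.assoc nonarch_suminf_mult c0_form_summable)

lemma nnorm_c0_form_le: "nnorm (c0_form x y) \<le> nnorm x * nnorm y"
  unfolding c0_form_def
  by (intro nnorm_suminf_le c0_form_summable)
    (simp add: nnorm_mult mult_mono nnorm_c0_nth_le)


section \<open>Bounded linear operators on the space of null sequences\<close>

definition c0_bounded_linear :: "('a::complete_nonarch_field c0 \<Rightarrow> 'a c0) \<Rightarrow> bool" where
  "c0_bounded_linear f \<longleftrightarrow>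
     Vector_Spaces.linear c0_scale c0_scale f \<and> (\<exists>B. \<forall>x. nnorm (f x) \<le> B * nnorm x)"

lemma c0_bounded_linear_iff:
  "c0_bounded_linear f \<longleftrightarrow>
     (\<forall>x y. f (x + y) = f x + f y) \<and> (\<forall>c x. f (c0_scale c x) = c0_scale c (f x)) \<and>
     (\<exists>B. \<forall>x. nnorm (f x) \<le> B * nnorm x)"
  using vector_space_c0_scale
  by (auto simp: c0_bounded_linear_def Vector_Spaces.linear_def module_hom_def
      module_hom_axioms_def vector_space_def module_def)

lemma c0_bounded_linearI:
  assumes "\<And>x y. f (x + y) = f x + f y" "\<And>c x. f (c0_scale c x) = c0_scale c (f x)"
    and "\<And>x. nnorm (f x) \<le> B * nnorm x"
  shows "c0_bounded_linear f"
  using assms c0_bounded_linear_iff by blast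

lemma c0_bounded_linear_zero:
  "c0_bounded_linear (\<lambda>_ :: 'a::complete_nonarch_field c0. 0 :: 'a c0)"
proof (rule c0_bounded_linearI[where B = 0])
  show "0 = c0_scale c (0 :: 'a c0)" for c
    by (rule c0_eqI) (simp add: c0_scale.rep_eq zero_c0.rep_eq)
qed simp_all

typedef (overloaded) 'a c0_op =
  "{f :: 'a::complete_nonarch_field c0 \<Rightarrow> 'a c0. c0_bounded_linear f}"
  morphisms app Abs_c0_op
  using c0_bounded_linear_zero by blast

setup_lifting type_definition_c0_op

lemma c0_op_eqI: "(\<And>x. app S x = app T x) \<Longrightarrow> S = T"
  by (metis app_inject ext)

lemma app_bound: "\<exists>B. \<forall>x. nnorm (app T x) \<le> B * nnorm x"
  using app[of T] by (simp add: c0_bounded_linear_iff)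

lemma c0_bounded_linear_combine:
  assumes "c0_bounded_linear f" "c0_bounded_linear g"
    and h_add: "\<And>x y x' y'. h (x + y) (x' + y') = h x x' + h y y'"
    and h_scale: "\<And>c x y. h (c0_scale c x) (c0_scale c y) = c0_scale c (h x y)"
    and h_le: "\<And>x y. nnorm (h x y) \<le> max (nnorm x) (nnorm y)"
  shows "c0_bounded_linear (\<lambda>x. h (f x) (g x))"
proof -
  obtain B C where B: "\<And>x. nnorm (f x) \<le> B * nnorm x" and C: "\<And>x. nnorm (g x) \<le> C * nnorm x"
    using assms(1,2) by (auto simp: c0_bounded_linear_iff)
  show ?thesis
  proof (rule c0_bounded_linearI[where B = "max B C"])
    fix x
    have "nnorm (h (f x) (g x)) \<le> max (B * nnorm x) (C * nnorm x)"
      using h_le[of "f x" "g x"] B[of x] C[of x] by linarith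
    also have "\<dots> \<le> max B C * nnorm x"
      by (simp add: mult_right_mono)
    finally show "nnorm (h (f x) (g x)) \<le> max B C * nnorm x" .
  qed (use assms in \<open>simp_all add: c0_bounded_linear_iff\<close>)
qed

lemma c0_scale_arith:
  "c0_scale c (x + y) = c0_scale c x + c0_scale c y"
  "c0_scale c (x - y) = c0_scale c x - c0_scale c y"
  "c0_scale c (- x) = - c0_scale c x"
  by (rule c0_eqI, simp add: c0_scale.rep_eq plus_c0.rep_eq minus_c0.rep_eq uminus_c0.rep_eq
      algebra_simps)+

lemma c0_scale_commute: "c0_scale c (c0_scale d x) = c0_scale d (c0_scale c x)"
  by (rule c0_eqI) (simp add: c0_scale.rep_eq)

instantiation c0_op :: (complete_nonarch_field) ab_group_add
begin

lift_definition zero_c0_op :: "'a c0_op" is "\<lambda>_. 0"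
  by (rule c0_bounded_linear_zero)
lift_definition plus_c0_op :: "'a c0_op \<Rightarrow> 'a c0_op \<Rightarrow> 'a c0_op" is "\<lambda>f g x. f x + g x"
  by (rule c0_bounded_linear_combine) (simp_all add: c0_scale_arith nnorm_ultra)
lift_definition minus_c0_op :: "'a c0_op \<Rightarrow> 'a c0_op \<Rightarrow> 'a c0_op" is "\<lambda>f g x. f x - g x"
  by (rule c0_bounded_linear_combine) (simp_all add: c0_scale_arith nnorm_diff_ultra)
lift_definition uminus_c0_op :: "'a c0_op \<Rightarrow> 'a c0_op" is "\<lambda>f x. - f x"
  by (auto simp: c0_bounded_linear_iff c0_scale_arith)

instance
  by standard (transfer, simp add: algebra_simps)+

end

lemma c0_op_bdd_above: "bdd_above (range (\<lambda>x. nnorm (app T x) / nnorm x))"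
proof -
  obtain B where B: "\<And>x. nnorm (app T x) \<le> B * nnorm x"
    using app_bound by blast
  have "nnorm (app T x) / nnorm x \<le> max B 0" for x
  proof (cases "x = 0")
    case False
    then have "0 < nnorm x" by (simp add: less_le)
    then have "nnorm (app T x) / nnorm x \<le> B"
      using B[of x] by (simp add: pos_divide_le_eq)
    then show ?thesis by simp
  qed simp
  then show ?thesis by (intro bdd_aboveI2)
qed

instantiation c0_op :: (complete_nonarch_field) nonarch_normed_group
begin

text \<open>The term for \<open>x = 0\<close> is \<open>0 / 0 = 0\<close> and does not affect the supremum.\<close>

definition nnorm_c0_op :: "'a c0_op \<Rightarrow> real" where
  "nnorm_c0_op T = (SUP x. nnorm (app T x) / nnorm x)"

definition dist_c0_op :: "'a c0_op \<Rightarrow> 'a c0_op \<Rightarrow> real" where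
  "dist_c0_op S T = nnorm (S - T)"

definition uniformity_c0_op :: "('a c0_op \<times> 'a c0_op) filter" where
  "uniformity_c0_op = (INF e\<in>{0<..}. principal {(x, y). dist x y < e})"

definition open_c0_op :: "'a c0_op set \<Rightarrow> bool" where
  "open_c0_op U = (\<forall>x\<in>U. \<forall>\<^sub>F (x', y) in uniformity. x' = x \<longrightarrow> y \<in> U)"

instance
proof
  have le: "nnorm (app T x) / nnorm x \<le> nnorm T" for T :: "'a c0_op" and x
    unfolding nnorm_c0_op_def by (rule cSUP_upper[OF UNIV_I c0_op_bdd_above])
  have least: "nnorm T \<le> B" if "\<And>x. nnorm (app T x) / nnorm x \<le> B" for T :: "'a c0_op" and B
    unfolding nnorm_c0_op_def using that by (intro cSUP_least) auto
  show ultra: "nnorm (S + T) \<le> max (nnorm S) (nnorm T)" for S T :: "'a c0_op"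
  proof (rule least)
    fix x
    have "nnorm (app (S + T) x) / nnorm x \<le> max (nnorm (app S x)) (nnorm (app T x)) / nnorm x"
      by (simp add: plus_c0_op.rep_eq nnorm_ultra divide_right_mono)
    also have "\<dots> \<le> max (nnorm S) (nnorm T)"
      using le[of S x] le[of T x] by (auto simp: max_def)
    finally show "nnorm (app (S + T) x) / nnorm x \<le> max (nnorm S) (nnorm T)" .
  qed
  have nonneg: "0 \<le> nnorm T" for T :: "'a c0_op"
    using le[of T 0] by simp
  show "dist S T = 0 \<longleftrightarrow> S = T" for S T :: "'a c0_op"
  proof
    assume *: "dist S T = 0"
    have "app S x = app T x" for x
    proof (cases "x = 0")
      case False
      then have "0 < nnorm x" by (simp add: less_le)
      then have "nnorm (app (S - T) x) \<le> 0"
        using le[of "S - T" x] * by (simp add: dist_c0_op_def divide_simps)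
      then have "nnorm (app (S - T) x) = 0"
        using nnorm_nonneg order_antisym by blast
      then show ?thesis by (simp add: minus_c0_op.rep_eq)
    next
      case True
      have "app R 0 = 0" for R :: "'a c0_op"
        using app[of R] by (simp add: c0_bounded_linear_iff) (metis add_cancel_right_right)
      with True show ?thesis by simp
    qed
    then show "S = T" by (rule c0_op_eqI)
  next
    assume "S = T"
    then show "dist S T = 0"
      by (simp add: dist_c0_op_def nnorm_c0_op_def zero_c0_op.rep_eq)
  qed
  have minus: "nnorm (S - T) = nnorm (T - S)" for S T :: "'a c0_op"
  proof -
    have "nnorm (app S x - app T x) = nnorm (app T x - app S x)" for x
      using nnorm_minus[of "app S x - app T x"] by simp
    then show ?thesis by (simp add: nnorm_c0_op_def minus_c0_op.rep_eq)
  qed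
  show "dist S T \<le> dist S R + dist T R" for S T R :: "'a c0_op"
    using ultra[of "S - R" "R - T"] nonneg[of "S - R"] nonneg[of "R - T"] minus[of T R]
    by (simp add: dist_c0_op_def)
qed (simp_all add: dist_c0_op_def uniformity_c0_op_def open_c0_op_def)

end

lift_definition op_id :: "'a::complete_nonarch_field c0_op" is "\<lambda>x. x"
  by (rule c0_bounded_linearI[where B = 1]) simp_all

lift_definition op_scale :: "'a::complete_nonarch_field \<Rightarrow> 'a c0_op \<Rightarrow> 'a c0_op"
  is "\<lambda>c f x. c0_scale c (f x)"
proof -
  fix c :: 'a and f :: "'a c0 \<Rightarrow> 'a c0"
  assume f: "c0_bounded_linear f"
  then obtain B where B: "\<And>x. nnorm (f x) \<le> B * nnorm x"
    by (auto simp: c0_bounded_linear_iff)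
  show "c0_bounded_linear (\<lambda>x. c0_scale c (f x))"
  proof (rule c0_bounded_linearI[where B = "nnorm c * B"])
    fix x
    have "nnorm (c0_scale c (f x)) \<le> nnorm c * nnorm (f x)"
      by (rule nnorm_c0_scale_le)
    also have "\<dots> \<le> nnorm c * (B * nnorm x)"
      by (intro mult_left_mono B) simp
    finally show "nnorm (c0_scale c (f x)) \<le> nnorm c * B * nnorm x"
      by (simp add: mult.assoc)
  qed (use f in \<open>simp_all add: c0_bounded_linear_iff c0_scale_arith c0_scale_commute\<close>)
qed

lift_definition op_proj :: "'a::complete_nonarch_field c0 \<Rightarrow> 'a c0_op"
  is "\<lambda>y x. c0_scale (c0_form x y / c0_form y y) y"
proof -
  fix y :: "'a c0"
  let ?f = "\<lambda>x. c0_scale (c0_form x y / c0_form y y) y"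
  show "c0_bounded_linear ?f"
  proof (rule c0_bounded_linearI[where B = "nnorm y * nnorm (inverse (c0_form y y)) * nnorm y"])
    fix x
    have "nnorm (?f x) \<le> nnorm (c0_form x y) * nnorm (inverse (c0_form y y)) * nnorm y"
      using nnorm_c0_scale_le[of "c0_form x y / c0_form y y" y]
      by (simp add: divide_inverse nnorm_mult)
    also have "\<dots> \<le> (nnorm x * nnorm y) * nnorm (inverse (c0_form y y)) * nnorm y"
      by (intro mult_right_mono nnorm_c0_form_le) simp_all
    finally show "nnorm (?f x) \<le> nnorm y * nnorm (inverse (c0_form y y)) * nnorm y * nnorm x"
      by (simp add: mult_ac)
  qed (rule c0_eqI, simp add: c0_form_add_left c0_form_scale_left c0_scale.rep_eq plus_c0.rep_eq
      add_divide_distrib algebra_simps)+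
qed

definition op_T :: "(nat \<Rightarrow> 'a::complete_nonarch_field c0) \<Rightarrow> 'a c0 \<Rightarrow> 'a c0_op" where
  "op_T y l = (\<Sum>i. op_scale (c0_nth l i) (op_proj (y i)))"

definition op_S :: "(nat \<Rightarrow> 'a::complete_nonarch_field c0) \<Rightarrow> 'a c0_op set" where
  "op_S y = {op_scale \<alpha> op_id + op_T y l |\<alpha> l. True}"


section \<open>Integration against set functions on clopen sets\<close>

definition clopenin :: "'b topology \<Rightarrow> 'b set \<Rightarrow> bool" where
  "clopenin X C \<longleftrightarrow> openin X C \<and> closedin X C"

text \<open>
  An element is a finite clopen partition together with the function that
  chooses the tag of each block.
\<close>

definition tagged_partitions :: "'b topology \<Rightarrow> ('b set set \<times> ('b set \<Rightarrow> 'b)) set" where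
  "tagged_partitions X =
     {(P, t). finite P \<and> partition_on (topspace X) P \<and> (\<forall>C\<in>P. clopenin X C) \<and>
        t \<in> (\<Pi>\<^sub>E C\<in>P. C)}"

definition refinement_filter :: "'b topology \<Rightarrow> ('b set set \<times> ('b set \<Rightarrow> 'b)) filter" where
  "refinement_filter X =
     (INF a\<in>tagged_partitions X.
        principal {b \<in> tagged_partitions X. refines (topspace X) (fst b) (fst a)})"

definition tagged_sum ::
  "('b \<Rightarrow> 'a::complete_nonarch_field) \<Rightarrow> ('b set \<Rightarrow> 'a) \<Rightarrow> 'b set set \<times> ('b set \<Rightarrow> 'b) \<Rightarrow> 'a" where
  "tagged_sum f \<mu> = (\<lambda>(P, t). \<Sum>C\<in>P. f (t C) * \<mu> C)"

definition clopen_integrable ::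
  "'b topology \<Rightarrow> ('b \<Rightarrow> 'a::complete_nonarch_field) \<Rightarrow> ('b set \<Rightarrow> 'a) \<Rightarrow> bool" where
  "clopen_integrable X f \<mu> \<longleftrightarrow> (\<exists>I. (tagged_sum f \<mu> \<longlongrightarrow> I) (refinement_filter X))"

definition clopen_integral ::
  "'b topology \<Rightarrow> ('b \<Rightarrow> 'a::complete_nonarch_field) \<Rightarrow> ('b set \<Rightarrow> 'a) \<Rightarrow> 'a" where
  "clopen_integral X f \<mu> = Lim (refinement_filter X) (tagged_sum f \<mu>)"

lemma tagged_partition_exists:
  assumes "finite P" "partition_on (topspace X) P" "\<And>C. C \<in> P \<Longrightarrow> clopenin X C"
  shows "\<exists>t. (P, t) \<in> tagged_partitions X"
proof -
  have "\<forall>C\<in>P. \<exists>x. x \<in> C"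
    using assms(2) by (metis partition_onD3 ex_in_conv)
  then obtain t where "\<forall>C\<in>P. t C \<in> C" by metis
  then have "(P, restrict t P) \<in> tagged_partitions X"
    using assms by (auto simp: tagged_partitions_def)
  then show ?thesis by blast
qed

lemma tagged_partitions_nonempty: "tagged_partitions X \<noteq> {}"
proof -
  have "\<exists>t. ({topspace X} - {{}}, t) \<in> tagged_partitions X"
    by (rule tagged_partition_exists) (auto simp: partition_on_def disjoint_def clopenin_def)
  then show ?thesis by blast
qed

lemma tagged_partitions_directed:
  assumes "a \<in> tagged_partitions X" "b \<in> tagged_partitions X"
  shows "\<exists>c\<in>tagged_partitions X.
    refines (topspace X) (fst c) (fst a) \<and> refines (topspace X) (fst c) (fst b)"
proof -
  obtain P s Q t where ab: "a = (P, s)" "b = (Q, t)" by (cases a, cases b)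
  define R where "R = common_refinement {P, Q}"
  have P: "finite P" "partition_on (topspace X) P" "\<And>C. C \<in> P \<Longrightarrow> clopenin X C"
    and Q: "finite Q" "partition_on (topspace X) Q" "\<And>C. C \<in> Q \<Longrightarrow> clopenin X C"
    using assms by (auto simp: ab tagged_partitions_def)
  have "\<exists>u. (R, u) \<in> tagged_partitions X"
  proof (rule tagged_partition_exists)
    show "finite R"
      unfolding R_def using P(1) Q(1) by (intro finite_common_refinement) auto
    show "partition_on (topspace X) R"
      unfolding R_def using P(2) Q(2) by (intro partition_on_common_refinement) auto
    show "clopenin X C" if "C \<in> R" for C
      using that P(3) Q(3)
      by (auto simp: R_def common_refinement clopenin_def Pi_iff)
  qed
  then obtain u where "(R, u) \<in> tagged_partitions X" by blast
  moreover have "refines (topspace X) R P" "refines (topspace X) R Q"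
    unfolding R_def using P(2) Q(2) by (auto intro!: refines_common_refinement)
  ultimately show ?thesis by (auto simp: ab intro!: bexI[of _ "(R, u)"])
qed

lemma eventually_refinement_filter:
  "eventually E (refinement_filter X) \<longleftrightarrow>
     (\<exists>a\<in>tagged_partitions X. \<forall>b\<in>tagged_partitions X.
        refines (topspace X) (fst b) (fst a) \<longrightarrow> E b)"
  unfolding refinement_filter_def
proof (subst eventually_INF_base)
  fix a b assume "a \<in> tagged_partitions X" "b \<in> tagged_partitions X"
  from tagged_partitions_directed[OF this]
  show "\<exists>x\<in>tagged_partitions X.
      principal {b \<in> tagged_partitions X. refines (topspace X) (fst b) (fst x)}
      \<le> inf (principal {b \<in> tagged_partitions X. refines (topspace X) (fst b) (fst a)})
          (principal {c \<in> tagged_partitions X. refines (topspace X) (fst c) (fst b)})"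
    by (auto intro: refines_trans)
next
  show "(\<exists>b\<in>tagged_partitions X. eventually E
          (principal {c \<in> tagged_partitions X. refines (topspace X) (fst c) (fst b)})) \<longleftrightarrow>
        (\<exists>a\<in>tagged_partitions X. \<forall>b\<in>tagged_partitions X.
          refines (topspace X) (fst b) (fst a) \<longrightarrow> E b)"
    unfolding eventually_principal by blast
qed (rule tagged_partitions_nonempty)

lemma refinement_filter_neq_bot: "refinement_filter X \<noteq> bot"
proof -
  have "\<not> eventually (\<lambda>_. False) (refinement_filter X)"
    using refines_refl by (fastforce simp: eventually_refinement_filter tagged_partitions_def)
  then show ?thesis by (auto simp: trivial_limit_def)
qed

lemma clopen_integral_eqI:
  "(tagged_sum f \<mu> \<longlongrightarrow> I) (refinement_filter X) \<Longrightarrow>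
     clopen_integrable X f \<mu> \<and> clopen_integral X f \<mu> = I"
  unfolding clopen_integrable_def clopen_integral_def
  using tendsto_Lim[OF refinement_filter_neq_bot] by blast


section \<open>The operator-valued measure on the one-point compactification\<close>

text \<open>\<^term>\<open>None\<close> is the point at infinity.\<close>

definition Nstar :: "nat option topology" where
  "Nstar = Alexandroff_compactification (discrete_topology UNIV)"

definition op_measure ::
  "(nat \<Rightarrow> 'a::complete_nonarch_field c0) \<Rightarrow> nat option set \<Rightarrow> 'a c0_op" where
  "op_measure y C =
     (if None \<notin> C then \<Sum>n | Some n \<in> C. op_proj (y n)
      else op_id - (\<Sum>n | Some n \<notin> C. op_proj (y n)))"

definition scalar_measure ::
  "(nat \<Rightarrow> 'a::complete_nonarch_field c0) \<Rightarrow> nat \<Rightarrow> nat \<Rightarrow> nat option set \<Rightarrow> 'a" where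
  "scalar_measure y i j C = c0_form (app (op_measure y C) (c0_basis i)) (c0_basis j)"

text \<open>
  On clopen sets, both sums in \<^const>\<open>op_measure\<close> range over finite sets, and
  \<^const>\<open>op_measure\<close> is additive.
\<close>

lemma clopenin_Nstar_iff:
  "clopenin Nstar C \<longleftrightarrow> (if None \<notin> C then finite {n. Some n \<in> C} else finite {n. Some n \<notin> C})"
proof (cases "None \<in> C")
  case False
  then have C: "C = Some ` {n. Some n \<in> C}"
    by (auto simp: image_iff) (metis option.exhaust)
  have "clopenin Nstar (Some ` {n. Some n \<in> C}) \<longleftrightarrow> finite {n. Some n \<in> C}"
    by (simp add: clopenin_def Nstar_def compactin_discrete_topology)
  with C False show ?thesis by simp
next
  case True
  then have C: "UNIV - C = Some ` {n. Some n \<notin> C}"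
    by (auto simp: image_iff) (metis option.exhaust)
  have top: "topspace Nstar = UNIV"
    by (auto simp: Nstar_def) (metis option.exhaust rangeI)
  have "clopenin Nstar C \<longleftrightarrow> clopenin Nstar (UNIV - C)"
    using openin_closedin_eq[of Nstar C] closedin_def[of Nstar C]
      openin_closedin_eq[of Nstar "UNIV - C"] closedin_def[of Nstar "UNIV - C"]
    by (auto simp: clopenin_def top Diff_Diff_Int)
  also have "\<dots> \<longleftrightarrow> finite {n. Some n \<notin> C}"
    by (simp add: C clopenin_def Nstar_def compactin_discrete_topology)
  finally show ?thesis using True by simp
qed

lemma op_measure_Un:
  assumes "clopenin Nstar C" "clopenin Nstar D" "C \<inter> D = {}"
  shows "op_measure y (C \<union> D) = op_measure y C + op_measure y D"
proof -
  have aux: "op_measure y (A \<union> B) = op_measure y A + op_measure y B"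
    if "None \<notin> B" "clopenin Nstar A" "clopenin Nstar B" "A \<inter> B = {}" for A B
  proof (cases "None \<in> A")
    case False
    have "{n. Some n \<in> A \<or> Some n \<in> B} = {n. Some n \<in> A} \<union> {n. Some n \<in> B}" by auto
    moreover have "{n. Some n \<in> A} \<inter> {n. Some n \<in> B} = {}" using that(4) by auto
    ultimately show ?thesis
      using that False by (simp add: op_measure_def clopenin_Nstar_iff sum.union_disjoint)
  next
    case True
    have *: "{n. Some n \<notin> A} = {n. Some n \<notin> A \<and> Some n \<notin> B} \<union> {n. Some n \<in> B}"
      using that(4) by auto
    have "finite {n. Some n \<notin> A}" "finite {n. Some n \<in> B}"
      using that True by (auto simp: clopenin_Nstar_iff)
    moreover from this have "finite {n. Some n \<notin> A \<and> Some n \<notin> B}"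
      by (auto intro: finite_subset[rotated])
    ultimately have "(\<Sum>n | Some n \<notin> A. op_proj (y n)) =
        (\<Sum>n | Some n \<notin> A \<and> Some n \<notin> B. op_proj (y n)) + (\<Sum>n | Some n \<in> B. op_proj (y n))"
      unfolding * by (intro sum.union_disjoint) auto
    then show ?thesis
      using that True by (simp add: op_measure_def)
  qed
  show ?thesis
  proof (cases "None \<in> D")
    case True
    with assms have "None \<notin> C" by auto
    with aux[of C D] assms show ?thesis by (simp add: Un_commute Int_commute add.commute)
  next
    case False
    with aux assms show ?thesis by blast
  qed
qed

end

(*
  For H = \<alpha> Id + T_\<lambda> take f(n) = \<alpha> + \<lambda>_n and f(0) = \<alpha>. Formal reality of the residue field
  forces |<y,y>| = 1 whenever y has norm 1, so all P_n, and hence all m(C), have norm at most 1.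
  On a partition that has the singletons {1}, ..., {N} as blocks, the operator-valued tagged sum is
  therefore within sup_{n > N} |\<lambda>_n| of \<alpha> Id + \<lambda>_1 P_1 + ... + \<lambda>_N P_N. So the tagged sums
  converge to H in operator norm, and the statement follows by taking matrix entries.
*)
theory Submission
  imports Defs
begin

section \<open>The residue field and the bilinear form\<close>

lemma nnorm_one [simp]: "nnorm (1::'a::complete_nonarch_field) = 1"
  using nnorm_mult[of "1::'a" 1] by simp

text \<open>The ultrametric inequality closes the unit ball under addition, multiplicativity of the
  norm closes it under products.\<close>

lemma ring_valuation_ring: "ring (valuation_ring :: 'a::complete_nonarch_field ring)"
proof (rule ringI)
  have add: "nnorm (x + y) \<le> 1" if "nnorm x \<le> 1" "nnorm y \<le> 1" for x y :: 'a
    using nnorm_ultra[of x y] that by simp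
  show "abelian_group (valuation_ring :: 'a ring)"
    by (rule abelian_groupI)
      (auto simp: valuation_ring_def add add.assoc add.commute intro: exI[of _ "- x" for x])
  show "monoid (valuation_ring :: 'a ring)"
    by (rule monoidI) (auto simp: valuation_ring_def nnorm_mult mult_le_one mult.assoc)
qed (auto simp: valuation_ring_def algebra_simps)

lemma ideal_valuation_ring:
  "ideal {x. nnorm x < 1} (valuation_ring :: 'a::complete_nonarch_field ring)"
proof (rule idealI[OF ring_valuation_ring])
  interpret ring "valuation_ring :: 'a ring" by (rule ring_valuation_ring)
  \<comment> \<open>The additive inverse of the ring record is given abstractly; identifying it with
    \<open>- x\<close> gives access to its norm.\<close>
  have neg: "\<ominus>\<^bsub>valuation_ring\<^esub> x = - x" if "nnorm x \<le> 1" for x :: 'a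
    by (rule minus_equality) (use that in \<open>auto simp: valuation_ring_def\<close>)
  show "subgroup {x. nnorm x < 1} (add_monoid (valuation_ring :: 'a ring))"
  proof (rule add.subgroupI)
    show "{x::'a. nnorm x < 1} \<subseteq> carrier valuation_ring" by (auto simp: valuation_ring_def)
    have "nnorm (0::'a) < 1" by simp
    then show "{x::'a. nnorm x < 1} \<noteq> {}" by blast
  next
    fix x :: 'a assume "x \<in> {x. nnorm x < 1}"
    then show "\<ominus>\<^bsub>valuation_ring\<^esub> x \<in> {x. nnorm x < 1}" by (simp add: neg)
  next
    fix x y :: 'a assume "x \<in> {x. nnorm x < 1}" "y \<in> {x. nnorm x < 1}"
    then show "x \<oplus>\<^bsub>valuation_ring\<^esub> y \<in> {x. nnorm x < 1}"
      using nnorm_ultra[of x y] by (simp add: valuation_ring_def)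
  qed
next
  fix a x :: 'a assume "a \<in> {x. nnorm x < 1}" "x \<in> carrier valuation_ring"
  then have "nnorm a * nnorm x < 1"
    using mult_left_le[of "nnorm x" "nnorm a"] by (auto simp: valuation_ring_def)
  then show "x \<otimes>\<^bsub>valuation_ring\<^esub> a \<in> {x. nnorm x < 1}" "a \<otimes>\<^bsub>valuation_ring\<^esub> x \<in> {x. nnorm x < 1}"
    by (simp_all add: valuation_ring_def nnorm_mult mult.commute)
qed

text \<open>Reduction modulo the ideal of elements of norm below 1 is a ring homomorphism. It sends
  the sum of squares to 0, so formal reality makes every residue vanish, which puts each
  \<open>a i\<close> with \<open>i < n\<close> into the ideal.\<close>

lemma formally_real_sum_squares:
  fixes a :: "nat \<Rightarrow> 'a::complete_nonarch_field"
  assumes real: "formally_real (residue_field :: 'a set ring)"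
    and a: "\<And>i. nnorm (a i) \<le> 1" and sum: "nnorm (\<Sum>i<n. a i * a i) < 1" and "i < n"
  shows "nnorm (a i) < 1"
proof -
  define I where "I = {x::'a. nnorm x < 1}"
  interpret V: ring "valuation_ring :: 'a ring" by (rule ring_valuation_ring)
  interpret I: ideal I "valuation_ring :: 'a ring" unfolding I_def by (rule ideal_valuation_ring)
  define h where "h x = I +>\<^bsub>valuation_ring\<^esub> x" for x
  have F: "residue_field = (valuation_ring :: 'a ring) Quot I"
    by (simp add: residue_field_def I_def)
  interpret h: ring_hom_ring "valuation_ring :: 'a ring" residue_field h
    using I.rcos_ring_hom_ring by (simp add: F h_def[abs_def])
  have carr: "a i \<in> carrier valuation_ring" for i
    using a by (simp add: valuation_ring_def)
  \<comment> \<open>Membership in the carrier is proved along with the identity because additivity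
    of \<open>h\<close> in the induction step requires it.\<close>
  have *: "(\<Oplus>\<^bsub>residue_field\<^esub>i\<in>{..<k}. h (a i) \<otimes>\<^bsub>residue_field\<^esub> h (a i)) =
      h (\<Sum>i<k. a i * a i) \<and> (\<Sum>i<k. a i * a i) \<in> carrier valuation_ring" for k
  proof (induction k)
    case 0
    show ?case using h.hom_zero V.zero_closed by (simp add: valuation_ring_def)
  next
    case (Suc k)
    have add: "(\<Sum>i<Suc k. a i * a i) =
        (a k \<otimes>\<^bsub>valuation_ring\<^esub> a k) \<oplus>\<^bsub>valuation_ring\<^esub> (\<Sum>i<k. a i * a i)"
      by (simp add: valuation_ring_def add.commute)
    show ?case
      unfolding add using Suc carr by (simp add: lessThan_Suc h.S.finsum_insert)
  qed
  have "(\<Sum>i<n. a i * a i) \<in> I" using sum by (simp add: I_def)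
  then have "h (\<Sum>i<n. a i * a i) = \<zero>\<^bsub>residue_field\<^esub>"
    using V.a_rcos_zero[OF I.ideal_axioms] by (simp add: h_def F FactRing_def)
  then have "h (a i) = \<zero>\<^bsub>residue_field\<^esub>" if "i < n" for i
    using real[unfolded formally_real_def, rule_format, of "\<lambda>i. h (a i)" n] * carr that by auto
  then have "I +>\<^bsub>valuation_ring\<^esub> a i = I"
    using \<open>i < n\<close> by (simp add: h_def F FactRing_def)
  then have "a i \<in> I" by (rule I.rcos_const_imp_mem[OF carr])
  then show ?thesis by (simp add: I_def)
qed

text \<open>Only finitely many entries of a null sequence have norm at least half of the positive
  number \<open>nnorm x\<close>, so the supremum is a maximum.\<close>

lemma nnorm_c0_attained:
  assumes "x \<noteq> 0"
  shows "\<exists>n. nnorm (c0_nth x n) = nnorm x"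
proof (rule ccontr)
  assume "\<nexists>n. nnorm (c0_nth x n) = nnorm x"
  then have less: "nnorm (c0_nth x n) < nnorm x" for n
    using nnorm_c0_nth_le[of x n] by (simp add: less_le)
  have pos: "0 < nnorm x" using assms by (simp add: less_le)
  then have "\<forall>\<^sub>F n in sequentially. nnorm (c0_nth x n) < nnorm x / 2"
    using c0_nth_tendsto[of x] by (intro order_tendstoD) (auto simp: tendsto_zero_nnorm_iff)
  then obtain N where N: "\<And>n. n \<ge> N \<Longrightarrow> nnorm (c0_nth x n) < nnorm x / 2"
    by (auto simp: eventually_sequentially)
  \<comment> \<open>If no entry attained the supremum, this finite maximum would be an upper bound
    of all entries strictly below it.\<close>
  define B where "B = Max (insert (nnorm x / 2) ((\<lambda>n. nnorm (c0_nth x n)) ` {..<N}))"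
  have "nnorm (c0_nth x n) \<le> B" for n
  proof (cases "n < N")
    case False
    then have "nnorm (c0_nth x n) \<le> nnorm x / 2" using N[of n] by simp
    also have "\<dots> \<le> B" unfolding B_def by (rule Max_ge) auto
    finally show ?thesis .
  qed (simp add: B_def)
  then have "nnorm x \<le> B" by (rule nnorm_c0_least)
  moreover have "B < nnorm x" unfolding B_def using less pos by simp
  ultimately show False by simp
qed

text \<open>The norm is at most 1 by the Cauchy-Schwarz estimate. Were it smaller, long partial sums
  of squares would have norm below 1, and formal reality would push every entry below 1, although
  some entry attains the norm 1 of \<open>y\<close>.\<close>

lemma nnorm_c0_form_self:
  fixes y :: "'a::complete_nonarch_field c0"
  assumes "formally_real (residue_field :: 'a set ring)" "nnorm y = 1"
  shows "nnorm (c0_form y y) = 1"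
proof (rule ccontr)
  assume "nnorm (c0_form y y) \<noteq> 1"
  then have "nnorm (c0_form y y) < 1"
    using nnorm_c0_form_le[of y y] assms(2) by simp
  moreover have "(\<lambda>k. nnorm (\<Sum>n<k. c0_nth y n * c0_nth y n)) \<longlonglongrightarrow> nnorm (c0_form y y)"
    unfolding c0_form_def by (intro tendsto_nnorm summable_LIMSEQ c0_form_summable)
  ultimately have "\<forall>\<^sub>F k in sequentially. nnorm (\<Sum>n<k. c0_nth y n * c0_nth y n) < 1"
    by (simp add: order_tendstoD)
  then obtain K where K: "\<And>k. k \<ge> K \<Longrightarrow> nnorm (\<Sum>n<k. c0_nth y n * c0_nth y n) < 1"
    by (auto simp: eventually_sequentially)
  have "y \<noteq> 0" using assms(2) by auto
  then obtain n where n: "nnorm (c0_nth y n) = 1"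
    using nnorm_c0_attained assms(2) by metis
  \<comment> \<open>The length \<open>max K (Suc n)\<close> makes the partial sum small and lets it
    contain the index \<open>n\<close>.\<close>
  have "nnorm (c0_nth y n) < 1"
    by (rule formally_real_sum_squares[OF assms(1) _ K[of "max K (Suc n)"]])
      (use nnorm_c0_nth_le[of y] assms(2) in auto)
  with n show False by simp
qed


section \<open>Completeness\<close>

lemma dist_c0_nth_le: "dist (c0_nth x n) (c0_nth y n) \<le> dist x y"
  using nnorm_c0_nth_le[of "x - y" n] by (simp add: dist_nnorm minus_c0.rep_eq)

lemma dist_c0_least: "(\<And>n. dist (c0_nth x n) (c0_nth y n) \<le> B) \<Longrightarrow> dist x y \<le> B"
  using nnorm_c0_least[of "x - y" B] by (simp add: dist_nnorm minus_c0.rep_eq)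

text \<open>Entrywise limits exist in the field, and the Cauchy condition makes the convergence
  uniform in the index. Uniformity shows both that the limit is a null sequence and that it is the
  limit in norm.\<close>

instance c0 :: (complete_nonarch_field) complete_space
proof
  fix X :: "nat \<Rightarrow> 'a c0" assume X: "Cauchy X"
  define L where "L n = lim (\<lambda>m. c0_nth (X m) n)" for n
  have "Cauchy (\<lambda>m. c0_nth (X m) n)" for n
    using X unfolding Cauchy_def by (meson dist_c0_nth_le order_le_less_trans)
  then have lim: "(\<lambda>m. c0_nth (X m) n) \<longlonglongrightarrow> L n" for n
    by (simp add: L_def Cauchy_convergent_iff convergent_LIMSEQ_iff)
  \<comment> \<open>Letting the second index tend to infinity weakens \<open>< e\<close> to
    \<open>\<le> e\<close>; the uses below therefore take \<open>e / 2\<close>.\<close>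
  have unif: "\<exists>M. \<forall>m\<ge>M. \<forall>n. dist (c0_nth (X m) n) (L n) \<le> e" if "e > 0" for e
  proof -
    obtain M where M: "\<And>m k. m \<ge> M \<Longrightarrow> k \<ge> M \<Longrightarrow> dist (X m) (X k) < e"
      using X \<open>e > 0\<close> unfolding Cauchy_def by metis
    have "dist (c0_nth (X m) n) (L n) \<le> e" if "m \<ge> M" for m n
    proof (rule Lim_bounded[OF tendsto_dist[OF tendsto_const lim]])
      show "\<forall>k\<ge>M. dist (c0_nth (X m) n) (c0_nth (X k) n) \<le> e"
        using M[OF \<open>m \<ge> M\<close>] by (meson dist_c0_nth_le less_imp_le order_trans)
    qed
    then show ?thesis by blast
  qed
  have "L \<longlonglongrightarrow> 0"
  proof (rule tendstoI)
    fix e :: real assume "e > 0"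
    then obtain M where M: "\<And>n. dist (c0_nth (X M) n) (L n) \<le> e / 2"
      using unif[of "e / 2"] by auto
    have "\<forall>\<^sub>F n in sequentially. dist (c0_nth (X M) n) 0 < e / 2"
      using c0_nth_tendsto \<open>e > 0\<close> by (intro tendstoD) auto
    then show "\<forall>\<^sub>F n in sequentially. dist (L n) 0 < e"
    proof (rule eventually_mono)
      fix n assume "dist (c0_nth (X M) n) 0 < e / 2"
      then show "dist (L n) 0 < e"
        using dist_triangle3[of "L n" 0 "c0_nth (X M) n"] M[of n] by simp
    qed
  qed
  then have nth_L: "c0_nth (Abs_c0 L) = L" by (simp add: Abs_c0_inverse)
  have "X \<longlonglongrightarrow> Abs_c0 L"
  proof (rule metric_LIMSEQ_I)
    fix e :: real assume "e > 0"
    then obtain M where M: "\<And>m n. m \<ge> M \<Longrightarrow> dist (c0_nth (X m) n) (L n) \<le> e / 2"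
      using unif[of "e / 2"] by auto
    have "dist (X m) (Abs_c0 L) \<le> e / 2" if "m \<ge> M" for m
      by (rule dist_c0_least) (use M[OF that] in \<open>simp add: nth_L\<close>)
    with \<open>e > 0\<close> show "\<exists>M. \<forall>m\<ge>M. dist (X m) (Abs_c0 L) < e"
      by (intro exI[of _ M]) force
  qed
  then show "convergent X" by (rule convergentI)
qed

section \<open>The operator norm and completeness of the space of operators\<close>

lemma tendsto_c0_scale:
  assumes "(X \<longlongrightarrow> x) F"
  shows "((\<lambda>n. c0_scale c (X n)) \<longlongrightarrow> c0_scale c x) F"
proof -
  have "((\<lambda>n. nnorm c * dist (X n) x) \<longlongrightarrow> nnorm c * 0) F"
    using assms by (intro tendsto_mult tendsto_const) (simp add: tendsto_dist_iff[symmetric])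
  then have "((\<lambda>n. dist (c0_scale c (X n)) (c0_scale c x)) \<longlongrightarrow> 0) F"
    unfolding mult_zero_right
    by (rule tendsto_sandwich[OF _ _ tendsto_const, rotated 2])
      (simp_all add: dist_nnorm c0_scale_arith(2)[symmetric] nnorm_c0_scale_le)
  then show ?thesis by (simp add: tendsto_dist_iff[symmetric])
qed

lemma app_add: "app T (x + y) = app T x + app T y"
  and app_scale: "app T (c0_scale c x) = c0_scale c (app T x)"
  using app[of T] by (auto simp: c0_bounded_linear_iff)

lemma app_zero [simp]: "app T 0 = 0"
  using app_add[of T 0 0] by simp

lemma nnorm_app_le: "nnorm (app T x) \<le> nnorm T * nnorm x"
proof (cases "x = 0")
  case False
  then have "0 < nnorm x" by (simp add: less_le)
  moreover have "nnorm (app T x) / nnorm x \<le> nnorm T"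
    unfolding nnorm_c0_op_def by (rule cSUP_upper[OF UNIV_I c0_op_bdd_above])
  ultimately show ?thesis by (simp add: pos_divide_le_eq)
qed simp

text \<open>The assumption \<open>0 \<le> B\<close> covers the term at \<open>x = 0\<close> of the
  supremum, which is 0 / 0 = 0.\<close>

lemma nnorm_c0_op_least:
  assumes "\<And>x. nnorm (app T x) \<le> B * nnorm x" "0 \<le> B"
  shows "nnorm T \<le> B"
  unfolding nnorm_c0_op_def
proof (rule cSUP_least)
  fix x
  show "nnorm (app T x) / nnorm x \<le> B"
  proof (cases "x = 0")
    case False
    then have "0 < nnorm x" by (simp add: less_le)
    then show ?thesis using assms(1)[of x] by (simp add: pos_divide_le_eq)
  qed (use assms(2) in simp)
qed simp

lemma dist_app_le: "dist (app S x) (app T x) \<le> dist S T * nnorm x"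
  using nnorm_app_le[of "S - T" x] by (simp add: dist_nnorm minus_c0_op.rep_eq)

text \<open>Pointwise limits exist because the space of null sequences is complete. The error at
  \<open>x\<close> is at most a small multiple of \<open>nnorm x\<close>, which gives boundedness of
  the limit and convergence in operator norm.\<close>

instance c0_op :: (complete_nonarch_field) complete_space
proof
  fix X :: "nat \<Rightarrow> 'a c0_op" assume X: "Cauchy X"
  define L where "L x = lim (\<lambda>m. app (X m) x)" for x
  have "Cauchy (\<lambda>m. app (X m) x)" for x
  proof (rule metric_CauchyI)
    fix e :: real assume "e > 0"
    \<comment> \<open>Adding 1 avoids a division by zero at \<open>x = 0\<close>.\<close>
    have pos: "0 < nnorm x + 1" using nnorm_nonneg[of x] by linarith
    then obtain M where M: "\<And>m n. m \<ge> M \<Longrightarrow> n \<ge> M \<Longrightarrow> dist (X m) (X n) < e / (nnorm x + 1)"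
      using X \<open>e > 0\<close> unfolding Cauchy_def by (meson divide_pos_pos)
    have "dist (app (X m) x) (app (X n) x) < e" if "m \<ge> M" "n \<ge> M" for m n
    proof -
      have "dist (app (X m) x) (app (X n) x) \<le> dist (X m) (X n) * nnorm x" by (rule dist_app_le)
      also have "\<dots> \<le> dist (X m) (X n) * (nnorm x + 1)" by (intro mult_left_mono) auto
      also have "\<dots> < e" using M[OF that] pos by (simp add: pos_less_divide_eq)
      finally show ?thesis .
    qed
    then show "\<exists>M. \<forall>m\<ge>M. \<forall>n\<ge>M. dist (app (X m) x) (app (X n) x) < e" by blast
  qed
  then have lim: "(\<lambda>m. app (X m) x) \<longlonglongrightarrow> L x" for x
    by (simp add: L_def Cauchy_convergent_iff convergent_LIMSEQ_iff)
  have unif: "\<exists>M. \<forall>m\<ge>M. \<forall>x. dist (app (X m) x) (L x) \<le> e * nnorm x" if "e > 0" for e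
  proof -
    obtain M where M: "\<And>m k. m \<ge> M \<Longrightarrow> k \<ge> M \<Longrightarrow> dist (X m) (X k) < e"
      using X \<open>e > 0\<close> unfolding Cauchy_def by metis
    have "dist (app (X m) x) (L x) \<le> e * nnorm x" if "m \<ge> M" for m x
    proof (rule Lim_bounded[OF tendsto_dist[OF tendsto_const lim]])
      show "\<forall>k\<ge>M. dist (app (X m) x) (app (X k) x) \<le> e * nnorm x"
        using M[OF \<open>m \<ge> M\<close>]
        by (meson dist_app_le less_imp_le mult_right_mono nnorm_nonneg order_trans)
    qed
    then show ?thesis by blast
  qed
  \<comment> \<open>With error constant 1, \<open>L\<close> differs from \<open>X M\<close> by a map
    with bound 1 and so inherits the bound \<open>max (nnorm (X M)) 1\<close>.\<close>
  obtain M where M: "\<And>x. dist (app (X M) x) (L x) \<le> nnorm x"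
    using unif[of 1] by auto
  have "c0_bounded_linear L"
  proof (rule c0_bounded_linearI[where B = "max (nnorm (X M)) 1"])
    show "L (x + z) = L x + L z" for x z
      using LIMSEQ_unique[OF lim[of "x + z"]] tendsto_add[OF lim[of x] lim[of z]]
      by (simp add: app_add)
    show "L (c0_scale c x) = c0_scale c (L x)" for c x
      using LIMSEQ_unique[OF lim[of "c0_scale c x"]] tendsto_c0_scale[OF lim[of x]]
      by (simp add: app_scale)
    fix x
    have "nnorm (L x) \<le> max (nnorm (app (X M) x)) (nnorm (app (X M) x - L x))"
      using nnorm_diff_ultra[of "app (X M) x" "app (X M) x - L x"] by simp
    also have "\<dots> \<le> max (nnorm (X M) * nnorm x) (1 * nnorm x)"
      using nnorm_app_le[of "X M" x] M[of x] by (intro max.mono) (simp_all add: dist_nnorm)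
    also have "\<dots> \<le> max (nnorm (X M)) 1 * nnorm x"
      by (intro max.boundedI mult_right_mono) auto
    finally show "nnorm (L x) \<le> max (nnorm (X M)) 1 * nnorm x" .
  qed
  then have app_L: "app (Abs_c0_op L) = L" by (simp add: Abs_c0_op_inverse)
  have "X \<longlonglongrightarrow> Abs_c0_op L"
  proof (rule metric_LIMSEQ_I)
    fix e :: real assume "e > 0"
    then obtain M where M: "\<And>m x. m \<ge> M \<Longrightarrow> dist (app (X m) x) (L x) \<le> e / 2 * nnorm x"
      using unif[of "e / 2"] by auto
    have "dist (X m) (Abs_c0_op L) \<le> e / 2" if "m \<ge> M" for m
      unfolding dist_nnorm
      by (rule nnorm_c0_op_least)
        (use M[OF that] \<open>e > 0\<close> in \<open>simp_all add: minus_c0_op.rep_eq app_L dist_nnorm\<close>)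
    with \<open>e > 0\<close> show "\<exists>M. \<forall>m\<ge>M. dist (X m) (Abs_c0_op L) < e"
      by (intro exI[of _ M]) force
  qed
  then show "convergent X" by (rule convergentI)
qed


section \<open>Operators and their matrix entries\<close>

text \<open>Supplies the distributive laws of \<open>op_scale\<close> over differences and finite
  sums that split the tagged sums below.\<close>

interpretation op: vector_space "op_scale :: 'a::complete_nonarch_field \<Rightarrow> _"
  by standard
    (rule c0_op_eqI, rule c0_eqI, simp add: op_scale.rep_eq plus_c0_op.rep_eq c0_scale.rep_eq
      plus_c0.rep_eq algebra_simps)+

lemma nnorm_op_scale_le: "nnorm (op_scale c T) \<le> nnorm c * nnorm T"
proof (rule nnorm_c0_op_least)
  fix x
  have "nnorm (app (op_scale c T) x) \<le> nnorm c * nnorm (app T x)"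
    by (simp add: op_scale.rep_eq nnorm_c0_scale_le)
  also have "\<dots> \<le> nnorm c * (nnorm T * nnorm x)"
    by (intro mult_left_mono nnorm_app_le) simp
  finally show "nnorm (app (op_scale c T) x) \<le> nnorm c * nnorm T * nnorm x"
    by (simp add: mult.assoc)
qed simp

lemma nnorm_op_id_le: "nnorm (op_id :: 'a::complete_nonarch_field c0_op) \<le> 1"
  by (rule nnorm_c0_op_least) (simp_all add: op_id.rep_eq)

text \<open>The hypothesis on the residue field enters here: the denominator
  \<open>c0_form y y\<close> has norm 1, so only the Cauchy-Schwarz estimate of the numerator
  remains.\<close>

lemma nnorm_op_proj_le:
  fixes y :: "'a::complete_nonarch_field c0"
  assumes "formally_real (residue_field :: 'a set ring)" "nnorm y = 1"
  shows "nnorm (op_proj y) \<le> 1"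
proof (rule nnorm_c0_op_least)
  fix x
  have inv: "nnorm (inverse (c0_form y y)) = 1"
  proof -
    have "c0_form y y \<noteq> 0" using nnorm_c0_form_self[OF assms] by auto
    then show ?thesis
      using nnorm_mult[of "c0_form y y" "inverse (c0_form y y)"] nnorm_c0_form_self[OF assms]
      by simp
  qed
  have "nnorm (app (op_proj y) x) \<le> nnorm (c0_form x y / c0_form y y) * nnorm y"
    by (simp add: op_proj.rep_eq nnorm_c0_scale_le)
  also have "\<dots> = nnorm (c0_form x y)"
    by (simp add: divide_inverse nnorm_mult inv assms(2))
  also have "\<dots> \<le> 1 * nnorm x"
    using nnorm_c0_form_le[of x y] assms(2) by simp
  finally show "nnorm (app (op_proj y) x) \<le> 1 * nnorm x" .
qed simp

text \<open>The terms are bounded by the entries of a null sequence, and null terms are summable in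
  a complete non-archimedean group. Thus the \<open>suminf\<close> that defines \<open>op_T\<close>
  is a genuine limit.\<close>

lemma op_T_sums:
  assumes "\<And>n. nnorm (op_proj (y n)) \<le> 1"
  shows "(\<lambda>n. op_scale (c0_nth l n) (op_proj (y n))) sums op_T y l"
  unfolding op_T_def
proof (intro summable_sums nonarch_summable, subst tendsto_zero_nnorm_iff)
  show "(\<lambda>n. nnorm (op_scale (c0_nth l n) (op_proj (y n)))) \<longlonglongrightarrow> 0"
  proof (rule tendsto_sandwich[OF _ _ tendsto_const])
    show "(\<lambda>n. nnorm (c0_nth l n)) \<longlonglongrightarrow> 0"
      using c0_nth_tendsto[of l] by (simp add: tendsto_zero_nnorm_iff)
    have "nnorm (op_scale (c0_nth l n) (op_proj (y n))) \<le> nnorm (c0_nth l n)" for n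
      using nnorm_op_scale_le[of "c0_nth l n" "op_proj (y n)"]
        mult_left_mono[OF assms[of n] nnorm_nonneg[of "c0_nth l n"]] by simp
    then show "\<forall>\<^sub>F n in sequentially.
        nnorm (op_scale (c0_nth l n) (op_proj (y n))) \<le> nnorm (c0_nth l n)"
      by simp
  qed simp
qed

section \<open>Matrix entries as linear functionals of the operator\<close>

definition op_entry :: "nat \<Rightarrow> nat \<Rightarrow> 'a::complete_nonarch_field c0_op \<Rightarrow> 'a" where
  "op_entry i j T = c0_form (app T (c0_basis i)) (c0_basis j)"

lemma op_entry_add: "op_entry i j (S + T) = op_entry i j S + op_entry i j T"
  and op_entry_scale: "op_entry i j (op_scale c T) = c * op_entry i j T"
  by (simp_all add: op_entry_def plus_c0_op.rep_eq op_scale.rep_eq c0_form_add_left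
      c0_form_scale_left)

lemma op_entry_diff: "op_entry i j (S - T) = op_entry i j S - op_entry i j T"
  using op_entry_add[of i j "S - T" T] by simp

lemma op_entry_sum: "op_entry i j (\<Sum>x\<in>A. F x) = (\<Sum>x\<in>A. op_entry i j (F x))"
  \<comment> \<open>This instance yields the value 0 at the zero operator, as needed for the empty
    sum.\<close>
  using op_entry_diff[of i j 0 0]
  by (induction A rule: infinite_finite_induct) (simp_all add: op_entry_add)

lemma nnorm_c0_basis_le: "nnorm (c0_basis i :: 'a::complete_nonarch_field c0) \<le> 1"
  by (rule nnorm_c0_least) (simp add: c0_basis.rep_eq)

text \<open>Basis vectors have norm at most 1. With linearity this makes entries 1-Lipschitz, so
  limits in operator norm pass to them.\<close>

lemma nnorm_op_entry_le: "nnorm (op_entry i j T) \<le> nnorm T"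
proof -
  have "nnorm (op_entry i j T) \<le> nnorm (app T (c0_basis i)) * nnorm (c0_basis j :: 'a c0)"
    unfolding op_entry_def by (rule nnorm_c0_form_le)
  also have "\<dots> \<le> nnorm (app T (c0_basis i)) * 1"
    by (intro mult_left_mono nnorm_c0_basis_le) simp
  also have "\<dots> \<le> nnorm T * nnorm (c0_basis i :: 'a c0) * 1"
    by (intro mult_right_mono nnorm_app_le) simp
  also have "\<dots> \<le> nnorm T * 1 * 1"
    by (intro mult_right_mono mult_left_mono nnorm_c0_basis_le) simp_all
  finally show ?thesis by simp
qed


section \<open>Integration against the operator-valued measure\<close>

lemma topspace_Nstar [simp]: "topspace Nstar = UNIV"
  by (auto simp: Nstar_def) (metis option.exhaust rangeI)

text \<open>By the ultrametric inequality the bound does not grow with the number of summands.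
  Arbitrary \<open>C\<close> is allowed because a sum over an infinite set is 0 by
  convention.\<close>

lemma nnorm_op_measure_le:
  assumes "\<And>n. nnorm (op_proj (y n)) \<le> 1"
  shows "nnorm (op_measure y C) \<le> 1"
proof -
  have sum: "nnorm (\<Sum>n\<in>A. op_proj (y n)) \<le> 1" for A
    by (rule nnorm_sum_le) (use assms in simp_all)
  show ?thesis
    using sum nnorm_op_id_le nnorm_diff_ultra[of op_id "\<Sum>n | Some n \<notin> C. op_proj (y n)"]
    by (auto simp: op_measure_def max_def split: if_splits intro: order_trans)
qed

lemma op_measure_Union:
  assumes "finite P" "disjoint P" "\<And>C. C \<in> P \<Longrightarrow> clopenin Nstar C"
  shows "(\<Sum>C\<in>P. op_measure y C) = op_measure y (\<Union>P)"
  using assms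
proof (induction P)
  case (insert C P)
  have "clopenin Nstar (\<Union>P)"
    using insert by (auto simp: clopenin_def intro!: closedin_Union)
  moreover have "C \<inter> \<Union>P = {}"
    using insert.prems(1) insert.hyps(2) by (auto simp: disjoint_def)
  ultimately show ?case
    using insert by (simp add: op_measure_Un pairwise_insert)
qed (simp add: op_measure_def)

text \<open>The constant \<open>f None\<close> integrates exactly, as the blocks have total measure
  \<open>op_id\<close>. A block \<open>{Some n}\<close> forces its tag and gives the explicit term.
  On every other block the coefficient minus \<open>f None\<close> has norm at most \<open>e\<close>
  and the measure has norm at most 1, so the ultrametric inequality bounds their sum by
  \<open>e\<close>, however many blocks there are.\<close>

lemma nnorm_tagged_op_sum_le:
  fixes f :: "nat option \<Rightarrow> 'a::complete_nonarch_field"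
  assumes proj: "\<And>n. nnorm (op_proj (y n)) \<le> 1"
    and P: "(P, t) \<in> tagged_partitions Nstar" "\<And>n. n < N \<Longrightarrow> {Some n} \<in> P"
    and f: "\<And>n. n \<ge> N \<Longrightarrow> nnorm (f (Some n) - f None) \<le> e" and "0 \<le> e"
  shows "nnorm ((\<Sum>C\<in>P. op_scale (f (t C)) (op_measure y C)) -
    (op_scale (f None) op_id + (\<Sum>n<N. op_scale (f (Some n) - f None) (op_proj (y n))))) \<le> e"
proof -
  have fin: "finite P" and part: "partition_on UNIV P"
    and clopen: "\<And>C. C \<in> P \<Longrightarrow> clopenin Nstar C" and t: "\<And>C. C \<in> P \<Longrightarrow> t C \<in> C"
    using P(1) by (auto simp: tagged_partitions_def)
  have disj: "disjoint P" using part by (rule partition_onD2)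
  define S where "S = (\<lambda>n. {Some n}) ` {..<N}"
  define F where "F C = op_scale (f (t C) - f None) (op_measure y C)" for C
  have "S \<subseteq> P" using P(2) by (auto simp: S_def)
  have total: "(\<Sum>C\<in>P. op_measure y C) = op_id"
    using op_measure_Union[OF fin disj clopen] partition_onD1[OF part]
    by (simp add: op_measure_def)
  have "(\<Sum>C\<in>P. op_scale (f (t C)) (op_measure y C)) =
      op_scale (f None) (\<Sum>C\<in>P. op_measure y C) + (\<Sum>C\<in>P. F C)"
    by (simp add: F_def op.scale_left_diff_distrib sum_subtractf op.scale_sum_right)
  also have "(\<Sum>C\<in>P. F C) = (\<Sum>C\<in>P - S. F C) + (\<Sum>C\<in>S. F C)"
    by (rule sum.subset_diff[OF \<open>S \<subseteq> P\<close> fin])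
  also have "(\<Sum>C\<in>S. F C) = (\<Sum>n<N. F {Some n})"
    unfolding S_def by (subst sum.reindex) (auto simp: inj_on_def)
  also have "\<dots> = (\<Sum>n<N. op_scale (f (Some n) - f None) (op_proj (y n)))"
  proof (rule sum.cong)
    fix n assume "n \<in> {..<N}"
    then have "t {Some n} = Some n" using t[of "{Some n}"] P(2) by simp
    then show "F {Some n} = op_scale (f (Some n) - f None) (op_proj (y n))"
      by (simp add: F_def op_measure_def)
  qed simp
  finally have "(\<Sum>C\<in>P. op_scale (f (t C)) (op_measure y C)) -
      (op_scale (f None) op_id + (\<Sum>n<N. op_scale (f (Some n) - f None) (op_proj (y n)))) =
      (\<Sum>C\<in>P - S. F C)"
    by (simp add: total)
  also have "nnorm \<dots> \<le> e"
  proof (rule nnorm_sum_le[OF _ \<open>0 \<le> e\<close>])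
    fix C assume C: "C \<in> P - S"
    have "nnorm (f (t C) - f None) \<le> e"
    proof (cases "t C")
      case None
      then show ?thesis using \<open>0 \<le> e\<close> by simp
    next
      case (Some n)
      \<comment> \<open>For smaller \<open>n\<close> the tag would lie both in \<open>C\<close> and
        in the block \<open>{Some n}\<close>; disjointness would then put \<open>C\<close> into
        \<open>S\<close>.\<close>
      have "n \<ge> N"
      proof (rule ccontr)
        assume "\<not> n \<ge> N"
        then have "{Some n} \<in> S" by (simp add: S_def)
        moreover from this have "C = {Some n}"
          using disjointD[OF disj, of C "{Some n}"] C \<open>S \<subseteq> P\<close> t[of C] Some by auto
        ultimately show False using C by simp
      qed
      then show ?thesis using f Some by simp
    qed
    then have "nnorm (f (t C) - f None) * nnorm (op_measure y C) \<le> e * 1"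
      using nnorm_op_measure_le[OF proj] \<open>0 \<le> e\<close> by (intro mult_mono) auto
    then show "nnorm (F C) \<le> e"
      using nnorm_op_scale_le[of "f (t C) - f None" "op_measure y C"] by (simp add: F_def)
  qed
  finally show ?thesis .
qed

text \<open>The partition \<open>Q\<close> into the first \<open>N\<close> singletons and the
  remaining set serves as threshold: in a refinement, the block containing \<open>Some n\<close>
  with \<open>n < N\<close> lies inside \<open>{Some n}\<close> and hence equals it.\<close>

lemma eventually_singletons_in_partition:
  "\<forall>\<^sub>F (P, t) in refinement_filter Nstar.
     (P, t) \<in> tagged_partitions Nstar \<and> (\<forall>n<N. {Some n} \<in> P)"
proof -
  define Q where "Q = insert (- Some ` {..<N}) ((\<lambda>n. {Some n}) ` {..<N})"
  \<comment> \<open>The remaining set is nonempty, as a block of a partition must be.\<close>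
  have "None \<in> - Some ` {..<N}" by auto
  then have part: "partition_on UNIV Q"
    by (auto simp: Q_def partition_on_def disjoint_def)
  have "clopenin Nstar C" if "C \<in> Q" for C
    using that by (auto simp: Q_def clopenin_Nstar_iff image_iff)
  then obtain s where s: "(Q, s) \<in> tagged_partitions Nstar"
    using tagged_partition_exists[of Q Nstar] part by (auto simp: Q_def)
  have "{Some n} \<in> P" if "refines UNIV P Q" "n < N" for P n
  proof -
    have P: "partition_on UNIV P" "\<And>X. X \<in> P \<Longrightarrow> \<exists>Y\<in>Q. X \<subseteq> Y"
      using that(1) by (auto simp: refines_def)
    obtain X where X: "X \<in> P" "Some n \<in> X"
      using partition_onD1[OF P(1)] by auto
    then obtain Y where "Y \<in> Q" "X \<subseteq> Y" using P(2) by blast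
    with X that(2) have "X = {Some n}" by (auto simp: Q_def)
    with X show ?thesis by simp
  qed
  with s show ?thesis
    unfolding eventually_refinement_filter by (intro bexI[of _ "(Q, s)"]) auto
qed

text \<open>The error has two parts, that of the tagged sum against the partial sum
  \<open>A N\<close> and the tail of the series for \<open>op_T y l\<close>; both are small for one
  large \<open>N\<close>.\<close>

lemma tagged_op_sum_tendsto:
  fixes f :: "nat option \<Rightarrow> 'a::complete_nonarch_field"
  assumes proj: "\<And>n. nnorm (op_proj (y n)) \<le> 1"
    and f: "\<And>n. f (Some n) = f None + c0_nth l n"
  shows "((\<lambda>(P, t). \<Sum>C\<in>P. op_scale (f (t C)) (op_measure y C))
    \<longlongrightarrow> op_scale (f None) op_id + op_T y l) (refinement_filter Nstar)"
proof (rule tendstoI)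
  fix e :: real assume "e > 0"
  define A where "A N = (\<Sum>n<N. op_scale (c0_nth l n) (op_proj (y n)))" for N
  have "A \<longlonglongrightarrow> op_T y l"
    using op_T_sums[where y = y and l = l, OF proj] by (simp add: sums_def A_def[abs_def])
  then obtain N1 where N1: "\<And>N. N \<ge> N1 \<Longrightarrow> dist (A N) (op_T y l) < e"
    using \<open>e > 0\<close> by (auto simp: lim_sequentially)
  obtain N2 where N2: "\<And>n. n \<ge> N2 \<Longrightarrow> nnorm (c0_nth l n) < e / 2"
    using c0_nth_tendsto[of l] \<open>e > 0\<close> unfolding lim_sequentially nnorm_eq_dist
    by (meson half_gt_zero)
  define N where "N = max N1 N2"
  show "\<forall>\<^sub>F x in refinement_filter Nstar.
      dist (case x of (P, t) \<Rightarrow> \<Sum>C\<in>P. op_scale (f (t C)) (op_measure y C))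
        (op_scale (f None) op_id + op_T y l) < e"
    using eventually_singletons_in_partition[of N]
  proof (rule eventually_mono, clarify)
    fix P t
    assume P: "(P, t) \<in> tagged_partitions Nstar" "\<forall>n<N. {Some n} \<in> P"
    let ?R = "\<Sum>C\<in>P. op_scale (f (t C)) (op_measure y C)"
    have "nnorm (?R - (op_scale (f None) op_id + A N)) \<le> e / 2"
      using nnorm_tagged_op_sum_le[OF proj P(1), of N f "e / 2"] P(2) N2 \<open>e > 0\<close>
      by (simp add: f A_def N_def less_imp_le)
    moreover have "nnorm (A N - op_T y l) < e"
      using N1[of N] by (simp add: dist_nnorm N_def)
    \<comment> \<open>The ultrametric inequality takes the maximum of the two errors, so neither
      needs half of \<open>e\<close>. The \<open>e / 2\<close> above only turns a weak bound into a
      strict one.\<close>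
    ultimately have "nnorm ((?R - (op_scale (f None) op_id + A N)) + (A N - op_T y l)) < e"
      using nnorm_ultra[of "?R - (op_scale (f None) op_id + A N)" "A N - op_T y l"] \<open>e > 0\<close>
      by linarith
    then show "dist ?R (op_scale (f None) op_id + op_T y l) < e"
      by (simp add: dist_nnorm algebra_simps)
  qed
qed

text \<open>Continuity is a condition at infinity alone: a preimage that misses \<open>None\<close>
  consists of isolated points, and one that contains \<open>None\<close> is cofinite by the
  convergence.\<close>

lemma continuous_map_Nstar:
  fixes f :: "nat option \<Rightarrow> 'a::topological_space"
  assumes "(\<lambda>n. f (Some n)) \<longlonglongrightarrow> f None"
  shows "continuous_map Nstar euclidean f"
proof -
  have "openin Nstar {x. f x \<in> U}" if "open U" for U
  proof (cases "f None \<in> U")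
    case True
    then have "\<forall>\<^sub>F n in cofinite. f (Some n) \<in> U"
      using assms \<open>open U\<close> by (simp add: topological_tendstoD cofinite_eq_sequentially)
    then have "finite {n. f (Some n) \<notin> U}" by (simp add: eventually_cofinite)
    with True have "clopenin Nstar {x. f x \<in> U}" by (simp add: clopenin_Nstar_iff)
    then show ?thesis by (simp add: clopenin_def)
  next
    case False
    then have "{x. f x \<in> U} = Some ` {n. f (Some n) \<in> U}"
      by (auto simp: image_iff) (metis option.exhaust)
    then show ?thesis by (simp add: Nstar_def)
  qed
  then show ?thesis by (simp add: continuous_map_def)
qed

theorem theorem2p12:
  fixes y :: "nat \<Rightarrow> 'a::complete_nonarch_field c0" and H :: "'a c0_op"
  assumes "formally_real (residue_field :: 'a set ring)"
    and "orthonormal_seq y"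
    and "H \<in> op_S y"
  shows "\<exists>f :: nat option \<Rightarrow> 'a. continuous_map Nstar euclidean f \<and>
    (\<forall>i j. clopen_integrable Nstar f (scalar_measure y i j) \<and>
       c0_form (app H (c0_basis i)) (c0_basis j) =
         clopen_integral Nstar f (scalar_measure y i j))"
proof -
  obtain \<alpha> l where H: "H = op_scale \<alpha> op_id + op_T y l"
    using assms(3) by (auto simp: op_S_def)
  define f where "f x = (case x of None \<Rightarrow> \<alpha> | Some n \<Rightarrow> \<alpha> + c0_nth l n)" for x
  have f: "f (Some n) = f None + c0_nth l n" for n by (simp add: f_def)
  have proj: "nnorm (op_proj (y n)) \<le> 1" for n
    using nnorm_op_proj_le[OF assms(1)] assms(2) by (simp add: orthonormal_seq_def)
  have "(\<lambda>n. f (Some n)) \<longlonglongrightarrow> f None"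
    using tendsto_add[OF tendsto_const c0_nth_tendsto[of l], of "f None"] by (simp add: f)
  then have "continuous_map Nstar euclidean f" by (rule continuous_map_Nstar)
  moreover have "(tagged_sum f (scalar_measure y i j) \<longlongrightarrow> op_entry i j H)
      (refinement_filter Nstar)" for i j
  proof -
    have dist_entry: "dist (op_entry i j S) (op_entry i j T) \<le> dist S T" for S T :: "'a c0_op"
      using nnorm_op_entry_le[of i j "S - T"] by (simp add: dist_nnorm op_entry_diff)
    define R where "R = (\<lambda>(P, t). \<Sum>C\<in>P. op_scale (f (t C)) (op_measure y C))"
    have "(R \<longlongrightarrow> H) (refinement_filter Nstar)"
      using tagged_op_sum_tendsto[OF proj f] by (simp add: R_def H f_def)
    then have "((\<lambda>x. dist (R x) H) \<longlongrightarrow> 0) (refinement_filter Nstar)"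
      by (simp add: tendsto_dist_iff[symmetric])
    then have "((\<lambda>x. dist (op_entry i j (R x)) (op_entry i j H)) \<longlongrightarrow> 0)
        (refinement_filter Nstar)"
      by (rule tendsto_sandwich[OF _ _ tendsto_const, rotated 2]) (simp_all add: dist_entry)
    \<comment> \<open>By linearity the entry of the operator-valued tagged sum is the tagged sum for
      the scalar measure.\<close>
    moreover have "op_entry i j (R x) = tagged_sum f (scalar_measure y i j) x" for x
      by (cases x) (simp add: R_def tagged_sum_def op_entry_sum op_entry_scale
          scalar_measure_def op_entry_def[symmetric])
    ultimately show ?thesis by (simp add: tendsto_dist_iff[symmetric])
  qed
  \<comment> \<open>The refinement filter is proper, so the limit found gives integrability and the
    value of the integral together.\<close>
  ultimately show ?thesis
    using clopen_integral_eqI unfolding op_entry_def by metis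
qed

end
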